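(* Let $q\ge1$ and $0\le r<q$ be integers, $\omega=e^{2\pi i/q}$, $\eta_\ell:=\exp\left(\frac i2\operatorname{Arg}(\omega^\ell)\right)$ for $0\le\ell<q$, and let $z\in\mathbb C$. For $\operatorname{Re}s>-1$, $$\sum_{\substack{n\ge0\\ n\equiv r\ (\mathrm{mod}\ q)}}\frac{\binom{2n}{n}}{4^n}\frac{P_n(z)}{2n+s+1}=\frac1q\sum_{\ell=0}^{q-1}\omega^{-r\ell}\int_0^1x^s\frac{\cosh(\sqrt z\,\arcsin(\eta_\ell x))}{\sqrt{1-\omega^\ell x^2}}\,dx.$$ For $\operatorname{Re}s>-2$, $$\sum_{\substack{n\ge1\\ n\equiv r\ (\mathrm{mod}\ q)}}\frac{2\cdot4^n}{n\binom{2n}{n}}\frac{Q_n(z)}{2n+s}=\frac1q\sum_{\ell=0}^{q-1}\omega^{-r\ell}\int_0^1x^s\frac{2\eta_\ell\sinh(2\sqrt z\,\arcsin(\eta_\ell x))}{\sqrt z\,\sqrt{1-\omega^\ell x^2}}\,dx,$$ where the second integrand is interpreted by its limiting value at $z=0$.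
   Context: $P_n(z):=\prod_{j=1}^{n}\left(1+\frac{z}{(2j-1)^2}\right)$ for $n\ge0$ and $Q_n(z):=\prod_{j=1}^{n-1}\left(1+\frac{z}{j^2}\right)$ for $n\ge1$. The principal argument satisfies $-\pi<\operatorname{Arg}w\le\pi$; square roots and logarithms are principal, and $\arcsin w=-i\operatorname{Log}(iw+\sqrt{1-w^2})$. The functions $\cosh(\sqrt z\,w)$ and $\sinh(2\sqrt z\,w)/\sqrt z$ are understood as entire functions of $z$ through their power series in $z$. *)

theory Defs
  imports "HOL-Analysis.Analysis" "HOL-Number_Theory.Cong"
begin

definition P_prod :: "nat \<Rightarrow> complex \<Rightarrow> complex" where
  "P_prod n z = (\<Prod>j\<in>{1..n}. 1 + z / (2 * of_nat j - 1)^2)"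

definition Q_prod :: "nat \<Rightarrow> complex \<Rightarrow> complex" where
  "Q_prod n z = (\<Prod>j\<in>{1..<n}. 1 + z / (of_nat j)^2)"

text \<open>\<open>cosh (\<surd>z w)\<close> and \<open>sinh (\<surd>z w) / \<surd>z\<close> as entire functions of \<open>z\<close>, by their power
  series in \<open>z\<close>.  In particular the second one has the value \<open>w\<close> at \<open>z = 0\<close>.  The lemmas below
  show that the series converge everywhere and agree with the closed forms.\<close>

definition cosh_sqrt :: "complex \<Rightarrow> complex \<Rightarrow> complex" where
  "cosh_sqrt z w = (\<Sum>k. w ^ (2 * k) / fact (2 * k) * z ^ k)"

definition sinh_sqrt :: "complex \<Rightarrow> complex \<Rightarrow> complex" where
  "sinh_sqrt z w = (\<Sum>k. w ^ (2 * k + 1) / fact (2 * k + 1) * z ^ k)"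

lemma cosh_sqrt_sums: "(\<lambda>k. w ^ (2 * k) / fact (2 * k) * z ^ k) sums cosh (csqrt z * w)"
proof -
  have "(\<lambda>k. if even k then (csqrt z * w) ^ k /\<^sub>R fact k else 0) sums cosh (csqrt z * w)"
    by (rule cosh_converges)
  moreover have "(if even n then (csqrt z * w) ^ n /\<^sub>R fact n else 0) = 0"
    if "n \<notin> range (\<lambda>k. 2 * k)" for n
    using that by (auto elim!: evenE)
  ultimately have "(\<lambda>k. (csqrt z * w) ^ (2 * k) /\<^sub>R fact (2 * k)) sums cosh (csqrt z * w)"
    using sums_mono_reindex[of "\<lambda>k. 2 * k" "\<lambda>k. if even k then (csqrt z * w) ^ k /\<^sub>R fact k else 0"]
    by (simp add: strict_mono_def del: fact_Suc power_Suc)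
  moreover have "(csqrt z * w) ^ (2 * k) /\<^sub>R fact (2 * k) = w ^ (2 * k) / fact (2 * k) * z ^ k" for k
    by (simp add: power_mult_distrib power_mult scaleR_conv_of_real divide_simps)
  ultimately show ?thesis by simp
qed

lemma sinh_sqrt_sums:
  assumes "z \<noteq> 0"
  shows "(\<lambda>k. w ^ (2 * k + 1) / fact (2 * k + 1) * z ^ k) sums (sinh (csqrt z * w) / csqrt z)"
proof -
  have "(\<lambda>k. if even k then 0 else (csqrt z * w) ^ k /\<^sub>R fact k) sums sinh (csqrt z * w)"
    by (rule sinh_converges)
  moreover have "(if even n then 0 else (csqrt z * w) ^ n /\<^sub>R fact n) = 0"
    if "n \<notin> range (\<lambda>k. 2 * k + 1)" for n
    using that by (auto elim!: oddE)
  ultimately have "(\<lambda>k. (csqrt z * w) ^ (2 * k + 1) /\<^sub>R fact (2 * k + 1)) sums sinh (csqrt z * w)"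
    using sums_mono_reindex[of "\<lambda>k. 2 * k + 1" "\<lambda>k. if even k then 0 else (csqrt z * w) ^ k /\<^sub>R fact k"]
    by (simp add: strict_mono_def del: fact_Suc power_Suc)
  then have "(\<lambda>k. (csqrt z * w) ^ (2 * k + 1) /\<^sub>R fact (2 * k + 1) / csqrt z)
      sums (sinh (csqrt z * w) / csqrt z)"
    by (rule sums_divide)
  moreover have "(csqrt z * w) ^ (2 * k + 1) /\<^sub>R fact (2 * k + 1) / csqrt z
      = w ^ (2 * k + 1) / fact (2 * k + 1) * z ^ k" for k
    using assms by (simp add: power_mult_distrib power_mult scaleR_conv_of_real divide_simps del: fact_Suc)
  ultimately show ?thesis by simp
qed

lemma cosh_sqrt_eq: "cosh_sqrt z w = cosh (csqrt z * w)"
  unfolding cosh_sqrt_def using cosh_sqrt_sums by (simp add: sums_iff)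

lemma sinh_sqrt_eq: "z \<noteq> 0 \<Longrightarrow> sinh_sqrt z w = sinh (csqrt z * w) / csqrt z"
  unfolding sinh_sqrt_def using sinh_sqrt_sums by (simp add: sums_iff)

lemma sinh_sqrt_0: "sinh_sqrt 0 w = w"
  unfolding sinh_sqrt_def using powser_sums_zero[of "\<lambda>k. w ^ (2 * k + 1) / fact (2 * k + 1)"]
  by (simp add: sums_iff)

end

theory Submission
  imports Defs "HOL-Complex_Analysis.Laurent_Convergence"
begin

text \<open>
  If \<open>F' = G / \<surd>(1 - u\<^sup>2)\<close> and \<open>G' = z F / \<surd>(1 - u\<^sup>2)\<close> on the unit disc, then \<open>y = F / \<surd>(1 - u\<^sup>2)\<close> satisfies
  \<open>(1 - u\<^sup>2) y' - u y = G\<close> and \<open>G' = z y\<close>, so its Taylor coefficients obey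
  \<open>(m + 1) (m + 2) Y\<^sub>m\<^sub>+\<^sub>2 = ((m + 1)\<^sup>2 + z) Y\<^sub>m\<close>.  Applied to \<open>cosh (\<surd>z arcsin u)\<close> and, with \<open>4 z\<close> for \<open>z\<close>, to
  \<open>sinh (2 \<surd>z arcsin u) / \<surd>z\<close>, this identifies the coefficients with those of the two series.  The
  recurrence also gives \<open>Y\<^sub>m = O(m\<^sup>-\<^sup>1\<^sup>/\<^sup>2)\<close>, hence absolute convergence of \<open>\<Sum> Y\<^sub>m \<eta>\<^sup>m / (m + s + 1)\<close>, which
  justifies integrating \<open>x\<^sup>s y(\<eta> x)\<close> termwise over \<open>(0, 1)\<close> for \<open>|\<eta>| = 1\<close>.  As \<open>\<eta>\<^sub>l\<^sup>2 = \<omega>\<^sup>l\<close>, averaging against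
  \<open>\<omega>\<^sup>-\<^sup>r\<^sup>l\<close> selects the residue class of \<open>r\<close> modulo \<open>q\<close>.
\<close>

section \<open>The arcsine on the unit disc and derivatives of the two entire functions\<close>

text \<open>Both sides are square roots of \<open>1 - u^2\<close>. The bound on
  \<open>Re (Arcsin u)\<close> makes the real part of the cosine positive, and this singles out the
  principal root.\<close>

lemma cos_Arcsin_unit_disc:
  assumes "norm u < 1"
  shows "cos (Arcsin u) = csqrt (1 - u\<^sup>2)"
proof -
  have "\<bar>Re u\<bar> < 1"
    using assms abs_Re_le_cmod[of u] by linarith
  then have "\<bar>Re (Arcsin u)\<bar> < pi / 2"
    by (rule Arcsin_bounds)
  then have "0 < cos (Re (Arcsin u))"
    by (intro cos_gt_zero_pi) auto
  then have "0 < Re (cos (Arcsin u))"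
    by (simp add: Re_cos add_pos_pos)
  moreover have "(cos (Arcsin u))\<^sup>2 = 1 - u\<^sup>2"
    by (simp add: cos_squared_eq)
  ultimately show ?thesis
    using csqrt_unique by metis
qed

lemma has_field_derivative_Arcsin_unit_disc:
  assumes "norm u < 1"
  shows "(Arcsin has_field_derivative 1 / csqrt (1 - u\<^sup>2)) (at u)"
proof -
  have "\<bar>Re u\<bar> < 1"
    using assms abs_Re_le_cmod[of u] by linarith
  then show ?thesis
    using has_field_derivative_Arcsin[of u] cos_Arcsin_unit_disc[OF assms]
    by (simp add: inverse_eq_divide)
qed

text \<open>Keeps the radicand off the branch cut, so that \<open>csqrt (1 - u^2)\<close> is
  differentiable and nonzero on the whole disc.\<close>

lemma one_minus_square_notin_nonpos_Reals:
  fixes u :: complex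
  assumes "norm u < 1"
  shows "1 - u\<^sup>2 \<notin> \<real>\<^sub>\<le>\<^sub>0"
proof
  assume "1 - u\<^sup>2 \<in> \<real>\<^sub>\<le>\<^sub>0"
  then have "Re (1 - u\<^sup>2) \<le> 0"
    by (auto simp: complex_nonpos_Reals_iff)
  then have "1 \<le> Re (u\<^sup>2)" by simp
  also have "\<dots> \<le> norm (u\<^sup>2)" by (rule complex_Re_le_cmod)
  also have "\<dots> < 1"
    using assms by (simp add: norm_power power_less_one_iff abs_square_less_1)
  finally show False by simp
qed

text \<open>The closed form divides by \<open>csqrt z\<close>, so \<open>z = 0\<close> is handled
  separately, where the function is the identity.\<close>

lemma has_field_derivative_sinh_sqrt:
  "(sinh_sqrt z has_field_derivative cosh_sqrt z w) (at w)"
proof (cases "z = 0")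
  case True
  then have "sinh_sqrt z = (\<lambda>w. w)" "cosh_sqrt z w = 1"
    by (auto simp: sinh_sqrt_0 cosh_sqrt_eq)
  then show ?thesis by simp
next
  case False
  then have "sinh_sqrt z = (\<lambda>w. sinh (csqrt z * w) / csqrt z)"
    by (auto simp: sinh_sqrt_eq)
  then show ?thesis
    using False by (auto simp: cosh_sqrt_eq intro!: derivative_eq_intros)
qed

lemma has_field_derivative_cosh_sqrt:
  "(cosh_sqrt z has_field_derivative z * sinh_sqrt z w) (at w)"
proof (cases "z = 0")
  case True
  then have "cosh_sqrt z = (\<lambda>_. 1)"
    by (auto simp: cosh_sqrt_eq)
  then show ?thesis using True by simp
next
  case False
  have *: "z / csqrt z = csqrt z"
    using False by (metis csqrt_eq_0 nonzero_mult_div_cancel_left power2_csqrt power2_eq_square)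
  have "cosh_sqrt z = (\<lambda>w. cosh (csqrt z * w))"
    by (auto simp: cosh_sqrt_eq)
  moreover have "z * sinh_sqrt z w = sinh (csqrt z * w) * csqrt z"
    using False * by (simp add: sinh_sqrt_eq) (metis mult.commute times_divide_eq_right)
  ultimately show ?thesis
    by (auto intro!: derivative_eq_intros)
qed

lemma sinh_sqrt_zero_right [simp]: "sinh_sqrt z 0 = 0"
  by (cases "z = 0") (simp_all add: sinh_sqrt_0 sinh_sqrt_eq)

lemma cosh_sqrt_zero_right [simp]: "cosh_sqrt z 0 = 1"
  by (simp add: cosh_sqrt_eq)

section \<open>Taylor coefficients from a pair of first-order differential equations\<close>

text \<open>Leaving \<open>F\<close> and \<open>G\<close> abstract covers both cases: a hyperbolic
  cosine of the arcsine with \<open>G\<close> equal to \<open>z\<close> times the sine, and a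
  hyperbolic sine of twice the arcsine with \<open>G\<close> equal to twice the cosine and
  \<open>4 * z\<close> as parameter. The starting values \<open>F 0\<close> and \<open>G 0\<close>
  decide which parity of coefficients vanishes.\<close>

lemma power_series_div_sqrt:
  fixes F G :: "complex \<Rightarrow> complex" and z :: complex
  assumes F: "\<And>u. norm u < 1 \<Longrightarrow> (F has_field_derivative G u / csqrt (1 - u\<^sup>2)) (at u)"
    and G: "\<And>u. norm u < 1 \<Longrightarrow> (G has_field_derivative z * F u / csqrt (1 - u\<^sup>2)) (at u)"
  obtains Y where "\<And>u. norm u < 1 \<Longrightarrow> (\<lambda>m. Y m * u ^ m) sums (F u / csqrt (1 - u\<^sup>2))"
    and "Y 0 = F 0" and "Y 1 = G 0"
    and "\<And>m. of_nat (Suc m) * of_nat (Suc (Suc m)) * Y (Suc (Suc m)) = ((of_nat (Suc m))\<^sup>2 + z) * Y m"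
proof -
  define w where "w = (\<lambda>u::complex. csqrt (1 - u\<^sup>2))"
  define y where "y = (\<lambda>u. F u / w u)"
  have w_sq: "(w u)\<^sup>2 = 1 - u\<^sup>2" for u
    by (simp add: w_def)
  have w_nz: "w u \<noteq> 0" if "norm u < 1" for u
    using one_minus_square_notin_nonpos_Reals[OF that] by (auto simp: w_def)
  have dw: "(w has_field_derivative - u / w u) (at u)" if "norm u < 1" for u
    unfolding w_def using w_nz[OF that] one_minus_square_notin_nonpos_Reals[OF that]
    by (auto intro!: derivative_eq_intros simp: w_def field_simps)
  have dy: "(y has_field_derivative (G u + u * y u) / (1 - u\<^sup>2)) (at u)" if "norm u < 1" for u
  proof -
    have "(y has_field_derivative (G u / w u * w u - F u * (- u / w u)) / (w u * w u)) (at u)"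
      unfolding y_def using F[OF that] w_nz[OF that]
      by (intro DERIV_divide dw that) (auto simp: w_def)
    also have "(G u / w u * w u - F u * (- u / w u)) / (w u * w u) = (G u + u * y u) / (w u)\<^sup>2"
      using w_nz[OF that] by (simp add: y_def power2_eq_square)
    finally show ?thesis by (simp add: w_sq)
  qed
  have hol: "y holomorphic_on ball 0 1" "G holomorphic_on ball 0 1"
    using dy G by (auto simp: holomorphic_on_open intro!: exI)
  define Y where "Y = fps_expansion y 0"
  define H where "H = fps_expansion G 0"
  have Y: "y has_fps_expansion Y" and H: "G has_fps_expansion H"
    unfolding Y_def H_def using hol by (auto intro!: has_fps_expansion_fps_expansion[of "ball 0 1"])
  have ev: "eventually (\<lambda>u::complex. norm u < 1) (nhds 0)"
    using eventually_nhds_in_open[of "ball 0 1" "0::complex"] by (simp add: dist_norm)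
  \<comment> \<open>Each differential equation is turned into an identity of formal power series:
    equality near 0 suffices, since expansions at 0 are unique.\<close>
  have y1: "(\<lambda>u. (1 - u ^ 2) * deriv y u - u * y u) has_fps_expansion
      (1 - fps_X ^ 2) * fps_deriv Y - fps_X * Y"
    by (intro fps_expansion_intros Y)
  have y2: "eventually (\<lambda>u. (1 - u ^ 2) * deriv y u - u * y u = G u) (nhds 0)"
    using ev
  proof eventually_elim
    case (elim u)
    then show ?case
      using DERIV_imp_deriv[OF dy[OF elim]] w_nz[OF elim] w_sq[of u] by auto
  qed
  have "G has_fps_expansion (1 - fps_X ^ 2) * fps_deriv Y - fps_X * Y"
    using y1 has_fps_expansion_cong[OF y2 refl] by blast
  then have 1: "H = (1 - fps_X ^ 2) * fps_deriv Y - fps_X * Y"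
    using H fps_expansion_unique_complex by blast
  have G1: "deriv G has_fps_expansion fps_deriv H"
    by (intro fps_expansion_intros H)
  have G2: "eventually (\<lambda>u. deriv G u = z * y u) (nhds 0)"
    using ev
  proof eventually_elim
    case (elim u)
    then show ?case
      using DERIV_imp_deriv[OF G[OF elim]] by (simp add: y_def w_def)
  qed
  have "(\<lambda>u. z * y u) has_fps_expansion fps_deriv H"
    using G1 has_fps_expansion_cong[OF G2 refl] by blast
  moreover have "(\<lambda>u. z * y u) has_fps_expansion fps_const z * Y"
    by (intro fps_expansion_intros Y)
  ultimately have 2: "fps_deriv H = fps_const z * Y"
    using fps_expansion_unique_complex by blast
  show ?thesis
  proof (rule that[of "fps_nth Y"])
    fix u :: complex assume "norm u < 1"
    then show "(\<lambda>m. fps_nth Y m * u ^ m) sums (F u / csqrt (1 - u\<^sup>2))"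
      using has_fps_expansion_imp_sums_complex[OF Y, of 1 u] hol(1)
      by (simp add: y_def w_def one_ereal_def)
  next
    show "fps_nth Y 0 = F 0"
      using has_fps_expansion_imp_0_eq_fps_nth_0[OF Y] by (simp add: y_def w_def)
    have "fps_nth H 0 = G 0"
      using has_fps_expansion_imp_0_eq_fps_nth_0[OF H] by simp
    then show "fps_nth Y 1 = G 0"
      by (simp add: 1 algebra_simps)
    fix m
    \<comment> \<open>Coefficient \<open>m + 1\<close> of the first identity and coefficient
      \<open>m\<close> of the second both involve \<open>H\<close> at \<open>m + 1\<close>;
      eliminating it leaves a recurrence for \<open>Y\<close> alone.\<close>
    have "fps_nth H (Suc m) = of_nat (Suc (Suc m)) * fps_nth Y (Suc (Suc m)) - of_nat (Suc m) * fps_nth Y m"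
    proof -
      have H_eq: "H = fps_deriv Y - fps_X * (fps_X * fps_deriv Y) - fps_X * Y"
        by (simp add: 1 algebra_simps power2_eq_square)
      show ?thesis
        unfolding H_eq by (cases m) (simp_all add: algebra_simps)
    qed
    moreover have "of_nat (Suc m) * fps_nth H (Suc m) = z * fps_nth Y m"
      using arg_cong[OF 2, of "\<lambda>f. fps_nth f m"] by simp
    moreover have "of_nat (Suc (Suc m)) = of_nat (Suc m) + (1 :: complex)"
      by simp
    ultimately show "of_nat (Suc m) * of_nat (Suc (Suc m)) * fps_nth Y (Suc (Suc m)) = ((of_nat (Suc m))\<^sup>2 + z) * fps_nth Y m"
      by algebra
  qed
qed

section \<open>Power integrals, coefficient decay and sums over roots of unity\<close>

text \<open>Integrability follows from the modulus \<open>x powr Re a\<close>. The antiderivative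
  \<open>x powr (a + 1) / (a + 1)\<close> is continuous up to 0 because
  \<open>Re (a + 1) > 0\<close>, so differentiating it in the interior is enough for the
  value.\<close>

lemma set_lebesgue_integral_powr_unit:
  fixes a :: complex
  assumes "Re a > -1"
  shows "set_integrable lborel {0<..<1::real} (\<lambda>x. of_real x powr a)"
    and "(LINT x:{0<..<1::real}|lborel. of_real x powr a) = 1 / (a + 1)"
proof -
  have "(\<lambda>x. x powr Re a) integrable_on {0<..<1}"
    using integrable_on_powr_from_0[of "Re a" 1] assms by (simp add: integrable_on_open_interval_real)
  then have "(\<lambda>x. x powr Re a) absolutely_integrable_on {0<..<1}"
    by (subst absolutely_integrable_on_iff_nonneg) auto
  then have re: "integrable lborel (\<lambda>x. indicat_real {0<..<1} x *\<^sub>R x powr Re a)"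
    unfolding set_integrable_def by (subst (asm) integrable_completion) auto
  show *: "set_integrable lborel {0<..<1::real} (\<lambda>x. of_real x powr a)"
    unfolding set_integrable_def
  proof (rule Bochner_Integration.integrable_bound[OF re])
    show "(\<lambda>x. indicat_real {0<..<1} x *\<^sub>R complex_of_real x powr a) \<in> borel_measurable lborel"
      by (auto intro!: borel_measurable_continuous_on_indicator continuous_intros)
    show "AE x in lborel. norm (indicat_real {0<..<1} x *\<^sub>R complex_of_real x powr a)
        \<le> norm (indicat_real {0<..<1} x *\<^sub>R x powr Re a)"
      by (auto simp: norm_powr_real_powr indicator_def)
  qed
  have a1: "a + 1 \<noteq> 0"
    using assms by (auto simp: complex_eq_iff)
  have "((\<lambda>x. complex_of_real x powr a) has_integral
      (of_real 1 powr (a + 1) / (a + 1) - of_real 0 powr (a + 1) / (a + 1))) {0..1}"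
  proof (rule fundamental_theorem_of_calculus_interior)
    show "continuous_on {0..1} (\<lambda>x. complex_of_real x powr (a + 1) / (a + 1))"
      using assms a1 by (intro continuous_intros) auto
    fix x :: real assume "x \<in> {0<..<1}"
    then have "complex_of_real x \<notin> \<real>\<^sub>\<le>\<^sub>0"
      by (auto simp: complex_nonpos_Reals_iff)
    then have "((\<lambda>u. u powr (a + 1) / (a + 1)) has_field_derivative of_real x powr a) (at (of_real x))"
      using a1 by (auto intro!: derivative_eq_intros has_field_derivative_powr[THEN DERIV_cong])
    then show "((\<lambda>x. complex_of_real x powr (a + 1) / (a + 1)) has_vector_derivative of_real x powr a) (at x)"
      using has_vector_derivative_real_field by fastforce
  qed simp
  then have "((\<lambda>x. complex_of_real x powr a) has_integral 1 / (a + 1)) {0<..<1}"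
    by (simp add: has_integral_Icc_iff_Ioo)
  then show "(LINT x:{0<..<1::real}|lborel. of_real x powr a) = 1 / (a + 1)"
    using set_borel_integral_eq_integral(2)[OF *] by (simp add: integral_unique)
qed

text \<open>The recurrence multiplies the modulus by at most \<open>(m + 1) / (m + 2)\<close> times
  \<open>1 + norm z / (m + 1)^2\<close>. The weight \<open>sqrt (m + 1)\<close> absorbs the first
  factor, and the product of the second ones stays below the exponential of a convergent
  series.\<close>

lemma two_step_recurrence_decay:
  fixes Y :: "nat \<Rightarrow> complex" and z :: complex
  assumes rec: "\<And>m. of_nat (Suc m) * of_nat (Suc (Suc m)) * Y (Suc (Suc m)) = ((of_nat (Suc m))\<^sup>2 + z) * Y m"
  obtains C where "\<And>m. norm (Y m) * sqrt (of_nat (Suc m)) \<le> C"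
proof -
  \<comment> \<open>The recurrence uses only every other factor of \<open>p\<close>. The surplus
    factors are at least 1, so a single product serves both parities, and \<open>K\<close> bounds
    the weighted starting values of both.\<close>
  define p where "p = (\<lambda>m. \<Prod>j\<in>{1..m}. 1 + norm z / (real j)\<^sup>2)"
  define K where "K = max (norm (Y 0)) (norm (Y 1) * sqrt 2)"
  have K0: "K \<ge> 0" by (simp add: K_def le_max_iff_disj)
  have p_Suc: "p (Suc m) = p m * (1 + norm z / (real (Suc m))\<^sup>2)" for m
    by (simp add: p_def)
  have p1: "p m \<ge> 1" for m
    unfolding p_def by (intro prod_ge_1) auto
  txt \<open>The recurrence loses only a convergent factor because \<open>(m + 1) (m + 3) \<le> (m + 2)\<^sup>2\<close>.\<close>
  have step: "norm (Y (Suc (Suc m))) * sqrt (real (Suc (Suc (Suc m))))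
      \<le> (1 + norm z / (real (Suc m))\<^sup>2) * (norm (Y m) * sqrt (real (Suc m)))" for m
  proof -
    define a where "a = real (Suc m)"
    have a: "a > 0" by (simp add: a_def)
    have s: "sqrt a * sqrt (a + 2) \<le> a + 1"
    proof -
      have "sqrt (a * (a + 2)) \<le> sqrt ((a + 1)\<^sup>2)"
        by (intro real_sqrt_le_mono) (simp add: power2_eq_square algebra_simps)
      then show ?thesis using a by (simp add: real_sqrt_mult)
    qed
    have "of_real a * of_real (a + 1) * Y (Suc (Suc m)) = ((of_real a)\<^sup>2 + z) * Y m"
      using rec[of m] by (simp add: a_def add_ac)
    then have "norm (of_real a * of_real (a + 1) * Y (Suc (Suc m))) = norm (((of_real a)\<^sup>2 + z) * Y m)"
      by simp
    then have "a * (a + 1) * norm (Y (Suc (Suc m))) = norm ((of_real a)\<^sup>2 + z) * norm (Y m)"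
      using a by (simp add: norm_mult del: of_real_add)
    also have "\<dots> \<le> (a\<^sup>2 + norm z) * norm (Y m)"
      using norm_triangle_ineq[of "(complex_of_real a)\<^sup>2" z] by (intro mult_right_mono) (auto simp: norm_power)
    finally have "a * (a + 1) * norm (Y (Suc (Suc m))) * (sqrt a * sqrt (a + 2))
        \<le> (a\<^sup>2 + norm z) * norm (Y m) * (a + 1)"
      using s a by (intro mult_mono[of "a * (a + 1) * norm (Y (Suc (Suc m)))"]) auto
    then have "(a + 1) * (a * sqrt a * (norm (Y (Suc (Suc m))) * sqrt (a + 2)))
        \<le> (a + 1) * ((a\<^sup>2 + norm z) * norm (Y m))"
      by (simp add: algebra_simps)
    then have "a * sqrt a * (norm (Y (Suc (Suc m))) * sqrt (a + 2)) \<le> (a\<^sup>2 + norm z) * norm (Y m)"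
      using a by (subst (asm) mult_le_cancel_left_pos) auto
    also have "\<dots> = a * sqrt a * ((1 + norm z / a\<^sup>2) * (norm (Y m) * sqrt a))"
    proof -
      have "a * sqrt a * ((1 + norm z / a\<^sup>2) * (norm (Y m) * sqrt a))
          = a * (sqrt a * sqrt a) * ((1 + norm z / a\<^sup>2) * norm (Y m))" by (simp only: mult_ac)
      also have "\<dots> = (a\<^sup>2 + norm z) * norm (Y m)"
        using a by (simp add: field_simps power2_eq_square)
      finally show ?thesis by (rule sym)
    qed
    finally have "norm (Y (Suc (Suc m))) * sqrt (a + 2) \<le> (1 + norm z / a\<^sup>2) * (norm (Y m) * sqrt a)"
      using a by (subst (asm) mult_le_cancel_left_pos) auto
    then show ?thesis by (simp add: a_def add_ac)
  qed
  have bound: "norm (Y m) * sqrt (real (Suc m)) \<le> K * p m" for m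
  proof (induction m rule: induct_nat_012)
    case 0 then show ?case by (simp add: p_def K_def)
  next
    case 1
    have "norm (Y 1) * sqrt 2 \<le> K * 1" by (simp add: K_def)
    also have "\<dots> \<le> K * p 1" by (intro mult_left_mono p1 K0)
    finally show ?case by simp
  next
    case (ge2 m)
    note step[of m]
    also have "(1 + norm z / (real (Suc m))\<^sup>2) * (norm (Y m) * sqrt (real (Suc m)))
        \<le> (1 + norm z / (real (Suc m))\<^sup>2) * (K * p m)"
      by (intro mult_left_mono ge2) auto
    also have "\<dots> = K * p (Suc m)" by (simp add: p_Suc)
    also have "\<dots> \<le> K * p (Suc (Suc m))"
      using p1[of "Suc m"] K0 by (intro mult_left_mono) (auto simp: p_Suc[of "Suc m"] mult_le_cancel_left1)
    finally show ?case .
  qed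
  have sm: "summable (\<lambda>j. norm z / (real j)\<^sup>2)"
    using summable_mult[OF inverse_power_summable[of 2, where 'a = real], of "norm z"] by (simp add: field_simps)
  have "p m \<le> exp (\<Sum>j. norm z / (real j)\<^sup>2)" for m
  proof -
    have "p m \<le> exp (\<Sum>j\<in>{1..m}. norm z / (real j)\<^sup>2)"
      unfolding p_def by (intro prod_le_exp_sum) auto
    also have "\<dots> \<le> exp (\<Sum>j. norm z / (real j)\<^sup>2)"
      by (auto intro!: sum_le_suminf sm)
    finally show ?thesis .
  qed
  then have "norm (Y m) * sqrt (real (Suc m)) \<le> K * exp (\<Sum>j. norm z / (real j)\<^sup>2)" for m
    using bound[of m] K0 by (meson mult_left_mono order_trans)
  then show ?thesis by (rule that)
qed

text \<open>A geometric sum with ratio \<open>v\<close>, a \<open>q\<close>-th root of unity that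
  equals 1 exactly on the residue class. The ratio is a quotient of powers because
  \<open>n - r\<close> would truncate for \<open>n < r\<close>.\<close>

lemma sum_root_of_unity_filter:
  fixes q r n :: nat and \<omega> :: complex
  assumes "q \<ge> 1" and "\<omega> = exp (2 * of_real pi * \<i> / of_nat q)"
  shows "(\<Sum>l<q. \<omega> powi (- (int r * int l)) * (\<omega> ^ l) ^ n) = (if [n = r] (mod q) then of_nat q else 0)"
proof -
  have nz: "\<omega> \<noteq> 0" by (simp add: assms(2))
  have pow: "\<omega> ^ j = exp (2 * of_real pi * \<i> * of_nat j / of_nat q)" for j
    unfolding assms(2) by (simp flip: exp_of_nat_mult add: mult_ac)
  define v where "v = \<omega> ^ n / \<omega> ^ r"
  have "(\<Sum>l<q. \<omega> powi (- (int r * int l)) * (\<omega> ^ l) ^ n) = (\<Sum>l<q. v ^ l)"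
    using nz by (intro sum.cong refl)
      (simp add: v_def power_int_minus field_simps flip: power_mult of_nat_mult)
  also have "\<dots> = (if [n = r] (mod q) then of_nat q else 0)"
  proof -
    have v1: "v = 1 \<longleftrightarrow> [n = r] (mod q)"
      using complex_root_unity_eq[OF assms(1), of n r] nz by (auto simp: v_def pow cong_def)
    have "\<omega> ^ q = 1"
      using assms(1) by (simp add: pow)
    then have "(\<omega> ^ j) ^ q = 1" for j
      by (metis mult.commute power_mult power_one)
    then have "v ^ q = 1"
      by (simp add: v_def power_divide)
    then show ?thesis
      using v1 geometric_sum[of v q] by auto
  qed
  finally show ?thesis .
qed

section \<open>Termwise integration and restriction to a residue class\<close>

text \<open>On the open interval \<open>e * x\<close> stays inside the disc, and the integrals of
  the norms of the terms are of order \<open>m powr (-3/2)\<close>, hence summable. The condition on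
  \<open>s\<close> concerns nonzero coefficients only, so a series without constant term admits
  \<open>Re s > -2\<close>.\<close>

lemma has_sum_integral_powr_power_series:
  fixes Y :: "nat \<Rightarrow> complex" and y :: "complex \<Rightarrow> complex" and z s e :: complex
  assumes y: "\<And>u. norm u < 1 \<Longrightarrow> (\<lambda>m. Y m * u ^ m) sums y u"
    and rec: "\<And>m. of_nat (Suc m) * of_nat (Suc (Suc m)) * Y (Suc (Suc m)) = ((of_nat (Suc m))\<^sup>2 + z) * Y m"
    and e: "norm e = 1"
    and s: "\<And>m. Y m \<noteq> 0 \<Longrightarrow> Re s + of_nat m > -1"
  shows "set_integrable lborel {0<..<1::real} (\<lambda>x. of_real x powr s * y (e * of_real x))"
    and "((\<lambda>m. Y m * e ^ m / (of_nat m + s + 1)) has_sum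
      (LINT x:{0<..<1::real}|lborel. of_real x powr s * y (e * of_real x))) UNIV"
proof -
  define f where "f = (\<lambda>m x. indicat_real {0<..<1} x *\<^sub>R (Y m * e ^ m * of_real x powr (s + of_nat m)))"
  obtain C where C: "\<And>m. norm (Y m) * sqrt (of_nat (Suc m)) \<le> C"
    using two_step_recurrence_decay[OF rec] by blast
  have YC: "norm (Y m) \<le> C" for m
  proof -
    have "norm (Y m) * 1 \<le> norm (Y m) * sqrt (of_nat (Suc m))"
      by (intro mult_left_mono) auto
    then show ?thesis using C[of m] by linarith
  qed
  have C0: "C \<ge> 0" using YC[of 0] norm_ge_zero order_trans by blast
  have int: "integrable lborel (f m)" for m
  proof (cases "Y m = 0")
    case False
    then have "set_integrable lborel {0<..<1::real} (\<lambda>x. of_real x powr (s + of_nat m))"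
      using s by (intro set_lebesgue_integral_powr_unit) auto
    then show ?thesis
      unfolding f_def set_integrable_def using integrable_mult_right by (simp add: scaleR_conv_of_real mult.left_commute)
  qed (simp add: f_def)
  have val: "integral\<^sup>L lborel (f m) = Y m * e ^ m / (of_nat m + s + 1)" for m
  proof (cases "Y m = 0")
    case False
    then have "(LINT x:{0<..<1::real}|lborel. of_real x powr (s + of_nat m)) = 1 / (s + of_nat m + 1)"
      using s by (intro set_lebesgue_integral_powr_unit) auto
    then show ?thesis
      unfolding f_def set_lebesgue_integral_def
      by (simp flip: mult_scaleR_right add: add_ac)
  qed (simp add: f_def)
  \<comment> \<open>The norm of a term is again a multiple of a power, with the real exponent
    \<open>Re s + m\<close>, so the complex power integral applies after embedding the
    reals.\<close>
  have nval: "(\<integral>x. norm (f m x) \<partial>lborel) = norm (Y m) / (of_nat m + Re s + 1)" for m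
  proof (cases "Y m = 0")
    case False
    have sm: "Re s + of_nat m > -1" by (rule s[OF False])
    have eq: "complex_of_real (norm (f m x)) = indicat_real {0<..<1} x *\<^sub>R (of_real (norm (Y m)) * of_real x powr (of_real (Re s + of_nat m)))"
      for x
      using e by (simp add: f_def indicator_def norm_mult norm_power norm_powr_real_powr powr_of_real del: of_real_add)
    have "complex_of_real (\<integral>x. norm (f m x) \<partial>lborel) = (\<integral>x. of_real (norm (f m x)) \<partial>lborel)"
      by simp
    also have "\<dots> = of_real (norm (Y m)) * (LINT x:{0<..<1::real}|lborel. of_real x powr (of_real (Re s + of_nat m)))"
      unfolding eq set_lebesgue_integral_def by (simp flip: mult_scaleR_right)
    also have "\<dots> = of_real (norm (Y m)) * (1 / (of_real (Re s + of_nat m) + 1))"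
      using sm by (subst set_lebesgue_integral_powr_unit) auto
    also have "\<dots> = of_real (norm (Y m) / (of_nat m + Re s + 1))"
      by (simp add: add_ac)
    finally show ?thesis using of_real_eq_iff by blast
  qed (simp add: f_def)
  have "summable (\<lambda>m. norm (Y m) / (of_nat m + Re s + 1))"
  proof (rule summable_comparison_test_ev)
    show "summable (\<lambda>m. 2 * C * real m powr (-3/2))"
      by (intro summable_mult) (simp add: summable_real_powr_iff)
    show "\<forall>\<^sub>F m in sequentially. norm (norm (Y m) / (of_nat m + Re s + 1)) \<le> 2 * C * real m powr (-3/2)"
      \<comment> \<open>Beyond this threshold \<open>m + Re s + 1\<close> is at least
        \<open>m / 2\<close>; together with the decay \<open>C / sqrt m\<close> this gives the
        constant \<open>2 * C\<close> and the exponent \<open>-3/2\<close>.\<close>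
      using eventually_gt_at_top[of "nat \<lceil>2 * \<bar>Re s\<bar> + 2\<rceil>"]
    proof eventually_elim
      case (elim m)
      then have m: "real m > 2 * \<bar>Re s\<bar> + 2" by linarith
      then have m0: "real m > 0" by linarith
      have "norm (Y m) * sqrt (real m) \<le> norm (Y m) * sqrt (of_nat (Suc m))"
        by (intro mult_left_mono) auto
      then have 1: "norm (Y m) \<le> C / sqrt (real m)"
        using C[of m] m0 by (simp add: field_simps)
      have 2: "real m / 2 \<le> of_nat m + Re s + 1"
        using m by linarith
      have "norm (Y m) / (of_nat m + Re s + 1) \<le> (C / sqrt (real m)) / (real m / 2)"
        using 1 2 m0 C0 by (intro frac_le) auto
      also have "\<dots> = 2 * C * (real m powr (-1) * real m powr (-1/2))"
        using m0 by (simp add: powr_half_sqrt[symmetric] powr_minus divide_simps)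
      also have "\<dots> = 2 * C * real m powr (-3/2)"
        by (subst powr_add[symmetric]) simp
      finally show ?case using 2 m0 by simp
    qed
  qed
  then have sm: "summable (\<lambda>m. \<integral>x. norm (f m x) \<partial>lborel)"
    by (simp add: nval)
  \<comment> \<open>For fixed \<open>x < 1\<close> bounded coefficients already give a geometric
    majorant; the square-root decay matters only for the integrals.\<close>
  have ptw: "summable (\<lambda>m. norm (f m x))" for x
  proof (cases "x \<in> {0<..<1}")
    case True
    show ?thesis
    proof (rule summable_comparison_test)
      show "summable (\<lambda>m. C * x powr Re s * x ^ m)"
        using True by (intro summable_mult summable_geometric) auto
      have "norm (norm (f m x)) \<le> C * x powr Re s * x ^ m" for m
        using True e YC[of m]
        by (simp add: f_def norm_mult norm_power norm_powr_real_powr powr_add powr_realpow mult_right_mono)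
      then show "\<exists>N. \<forall>m\<ge>N. norm (norm (f m x)) \<le> C * x powr Re s * x ^ m" by blast
    qed
  qed (simp add: f_def)
  have sumf: "(\<Sum>m. f m x) = indicat_real {0<..<1} x *\<^sub>R (of_real x powr s * y (e * of_real x))" for x
  proof (cases "x \<in> {0<..<1}")
    case True
    then have "norm (e * of_real x) < 1" using e by (simp add: norm_mult)
    then have "(\<lambda>m. of_real x powr s * (Y m * (e * of_real x) ^ m)) sums (of_real x powr s * y (e * of_real x))"
      by (intro sums_mult y)
    moreover have "of_real x powr s * (Y m * (e * of_real x) ^ m) = f m x" for m
      using True by (simp add: f_def powr_add power_mult_distrib)
    ultimately show ?thesis using True by (simp add: sums_iff)
  qed (simp add: f_def)
  have ae: "AE x in lborel. summable (\<lambda>m. norm (f m x))" using ptw by simp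
  show "set_integrable lborel {0<..<1::real} (\<lambda>x. of_real x powr s * y (e * of_real x))"
    using integrable_suminf[OF int ae sm] by (simp add: sumf set_integrable_def)
  have "(\<lambda>m. Y m * e ^ m / (of_nat m + s + 1)) sums (LINT x:{0<..<1::real}|lborel. of_real x powr s * y (e * of_real x))"
    using sums_integral[OF int ae sm] by (simp add: sumf set_lebesgue_integral_def val)
  \<comment> \<open>\<open>has_sum\<close> is unordered summation, so absolute convergence has to
    accompany \<open>sums\<close>.\<close>
  moreover have "summable (\<lambda>m. norm (Y m * e ^ m / (of_nat m + s + 1)))"
  proof (rule summable_comparison_test)
    show "\<exists>N. \<forall>m\<ge>N. norm (norm (Y m * e ^ m / (of_nat m + s + 1))) \<le> (\<integral>x. norm (f m x) \<partial>lborel)"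
      using integral_norm_bound[of lborel] by (auto simp flip: val)
  qed (rule sm)
  ultimately show "((\<lambda>m. Y m * e ^ m / (of_nat m + s + 1)) has_sum
      (LINT x:{0<..<1::real}|lborel. of_real x powr s * y (e * of_real x))) UNIV"
    by (intro norm_summable_imp_has_sum)
qed

lemma has_sum_sum:
  fixes f :: "'i \<Rightarrow> 'a \<Rightarrow> 'b :: topological_comm_monoid_add"
  assumes "finite L" and "\<And>l. l \<in> L \<Longrightarrow> (f l has_sum S l) A"
  shows "((\<lambda>x. \<Sum>l\<in>L. f l x) has_sum (\<Sum>l\<in>L. S l)) A"
  using assms by (induction L rule: finite_induct) (auto intro!: has_sum_add)

text \<open>Averaging the finitely many twisted sums multiplies each term by the root-of-unity
  filter, and the vanishing terms are then dropped from the index set. A general \<open>A\<close>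
  also covers the series that starts at \<open>n = 1\<close>.\<close>

lemma has_sum_residue_class:
  fixes q r :: nat and \<omega> :: complex and t :: "nat \<Rightarrow> complex"
  assumes "q \<ge> 1" and \<omega>: "\<omega> = exp (2 * of_real pi * \<i> / of_nat q)"
    and I: "\<And>l. l < q \<Longrightarrow> ((\<lambda>n. t n * (\<omega> ^ l) ^ n) has_sum I l) A"
  shows "(t has_sum 1 / of_nat q * (\<Sum>l<q. \<omega> powi (- (int r * int l)) * I l)) {n \<in> A. [n = r] (mod q)}"
proof -
  have "((\<lambda>n. 1 / of_nat q * (\<Sum>l<q. \<omega> powi (- (int r * int l)) * (t n * (\<omega> ^ l) ^ n)))
      has_sum 1 / of_nat q * (\<Sum>l<q. \<omega> powi (- (int r * int l)) * I l)) A"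
    by (intro has_sum_cmult_right has_sum_sum I) auto
  moreover have "1 / of_nat q * (\<Sum>l<q. \<omega> powi (- (int r * int l)) * (t n * (\<omega> ^ l) ^ n))
      = (if [n = r] (mod q) then t n else 0)" for n
  proof -
    have "(\<Sum>l<q. \<omega> powi (- (int r * int l)) * (t n * (\<omega> ^ l) ^ n))
        = t n * (\<Sum>l<q. \<omega> powi (- (int r * int l)) * (\<omega> ^ l) ^ n)"
      by (simp add: sum_distrib_left mult_ac)
    then show ?thesis
      using sum_root_of_unity_filter[OF assms(1) \<omega>, of r n] assms(1) by simp
  qed
  ultimately have "((\<lambda>n. if [n = r] (mod q) then t n else 0)
      has_sum 1 / of_nat q * (\<Sum>l<q. \<omega> powi (- (int r * int l)) * I l)) A"
    by simp
  then show ?thesis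
    by (subst (asm) has_sum_cong_neutral[where T = "{n \<in> A. [n = r] (mod q)}" and g = t]) auto
qed

section \<open>Central binomial coefficients and the explicit Taylor coefficients\<close>

text \<open>The extra factor \<open>Suc n\<close> lets the absorption identity be applied twice,
  with the symmetry of row \<open>2 * n + 1\<close> in between; it is cancelled at the end.\<close>

lemma central_binomial_Suc:
  "Suc n * ((2 * Suc n) choose Suc n) = 2 * (2 * n + 1) * ((2 * n) choose n)"
proof -
  have "(2 * n + 1) choose n = (2 * n + 1) choose Suc n"
    by (subst binomial_symmetric) auto
  then have *: "Suc (2 * n) choose n = Suc (2 * n) choose Suc n"
    by (simp only: Suc_eq_plus1)
  have "Suc n * (Suc n * (Suc (Suc (2 * n)) choose Suc n))
      = Suc n * (Suc (Suc (2 * n)) * (Suc (2 * n) choose n))"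
    by (simp only: Suc_times_binomial)
  also have "\<dots> = Suc (Suc (2 * n)) * (Suc n * (Suc (2 * n) choose Suc n))"
    unfolding * by (simp only: mult_ac)
  also have "\<dots> = Suc (Suc (2 * n)) * (Suc (2 * n) * ((2 * n) choose n))"
    by (simp only: Suc_times_binomial)
  also have "\<dots> = Suc n * (2 * (2 * n + 1) * ((2 * n) choose n))"
    by (simp add: algebra_simps)
  finally have "Suc n * (Suc (Suc (2 * n)) choose Suc n) = 2 * (2 * n + 1) * ((2 * n) choose n)"
    by (simp only: mult_cancel1) simp
  then show ?thesis
    by (simp only: mult_Suc_right add_2_eq_Suc)
qed

lemma central_binomial_Suc':
  "of_nat ((2 * Suc n) choose Suc n)
    = 2 * (2 * of_nat n + 1) * of_nat ((2 * n) choose n) / (of_nat (Suc n) :: complex)"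
proof -
  have "of_nat (Suc n) * of_nat ((2 * Suc n) choose Suc n)
      = (2 * (2 * of_nat n + 1) * of_nat ((2 * n) choose n) :: complex)"
    using arg_cong[OF central_binomial_Suc[of n], of "of_nat :: nat \<Rightarrow> complex"]
    by (simp only: of_nat_mult of_nat_add of_nat_numeral of_nat_1)
  then show ?thesis
    by (simp only: nonzero_eq_divide_eq[OF of_nat_neq_0] mult.commute)
qed

lemma two_times_of_nat_plus_one_neq_0: "2 * of_nat n + 1 \<noteq> (0 :: complex)"
  using of_nat_neq_0[of "2 * n", where 'a = complex] by (simp add: add.commute)

text \<open>With \<open>a = 2 * n + 1\<close> and \<open>b = 2 * n + 2\<close>, the ratio
  \<open>(a^2 + z) / (a * b)\<close> from the recurrence splits into \<open>a / b\<close>, the ratio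
  of consecutive \<open>binomial / 4^n\<close>, and \<open>1 + z / a^2\<close>, the new factor of
  \<open>P_prod\<close>. The odd coefficients vanish because \<open>G 0 = 0\<close>.\<close>

lemma power_series_cosh_sqrt_Arcsin:
  obtains Y where
    "\<And>u. norm u < 1 \<Longrightarrow> (\<lambda>m. Y m * u ^ m) sums (cosh_sqrt z (Arcsin u) / csqrt (1 - u\<^sup>2))"
    "\<And>m. of_nat (Suc m) * of_nat (Suc (Suc m)) * Y (Suc (Suc m)) = ((of_nat (Suc m))\<^sup>2 + z) * Y m"
    "\<And>n. Y (2 * n) = of_nat ((2 * n) choose n) / 4 ^ n * P_prod n z"
    "\<And>n. Y (Suc (2 * n)) = 0"
proof -
  have F: "((\<lambda>u. cosh_sqrt z (Arcsin u)) has_field_derivative z * sinh_sqrt z (Arcsin u) / csqrt (1 - u\<^sup>2)) (at u)"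
    and G: "((\<lambda>u. z * sinh_sqrt z (Arcsin u)) has_field_derivative z * cosh_sqrt z (Arcsin u) / csqrt (1 - u\<^sup>2)) (at u)"
    if "norm u < 1" for u
    using DERIV_chain2[OF has_field_derivative_cosh_sqrt has_field_derivative_Arcsin_unit_disc[OF that]]
      DERIV_cmult[OF DERIV_chain2[OF has_field_derivative_sinh_sqrt has_field_derivative_Arcsin_unit_disc[OF that]]]
    by simp_all
  obtain Y where Y: "\<And>u. norm u < 1 \<Longrightarrow> (\<lambda>m. Y m * u ^ m) sums (cosh_sqrt z (Arcsin u) / csqrt (1 - u\<^sup>2))"
    and Y0: "Y 0 = cosh_sqrt z (Arcsin 0)" and Y1: "Y 1 = z * sinh_sqrt z (Arcsin 0)"
    and rec: "\<And>m. of_nat (Suc m) * of_nat (Suc (Suc m)) * Y (Suc (Suc m)) = ((of_nat (Suc m))\<^sup>2 + z) * Y m"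
    using power_series_div_sqrt[OF F G] by blast
  have even: "Y (2 * n) = of_nat ((2 * n) choose n) / 4 ^ n * P_prod n z" for n
  proof (induction n)
    case 0 show ?case by (simp add: Y0 P_prod_def)
  next
    case (Suc n)
    define a where "a = 2 * of_nat n + (1 :: complex)"
    define b where "b = of_nat (Suc n) * (2 :: complex)"
    have nz: "a \<noteq> 0" "b \<noteq> 0"
      unfolding a_def b_def by (rule two_times_of_nat_plus_one_neq_0) (auto simp del: of_nat_Suc)
    have P: "P_prod (Suc n) z = P_prod n z * (1 + z / a\<^sup>2)"
      by (simp add: P_prod_def a_def algebra_simps)
    have bin: "of_nat ((2 * Suc n) choose Suc n) = 4 * a * of_nat ((2 * n) choose n) / b"
      using nz(2) unfolding central_binomial_Suc' a_def b_def by (auto simp: divide_simps simp del: of_nat_Suc)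
    have "of_nat (Suc (2 * n)) = a" "of_nat (Suc (Suc (2 * n))) = b" "Suc (Suc (2 * n)) = 2 * Suc n"
      by (simp_all add: a_def b_def)
    with rec[of "2 * n"] have "a * b * Y (2 * Suc n) = (a\<^sup>2 + z) * Y (2 * n)"
      by metis
    then have "Y (2 * Suc n) = (a\<^sup>2 + z) * Y (2 * n) / (a * b)"
      using nz by (simp add: field_simps)
    also have "\<dots> = of_nat ((2 * Suc n) choose Suc n) / 4 ^ Suc n * P_prod (Suc n) z"
      unfolding P bin Suc.IH using nz by (simp add: field_simps power2_eq_square)
    finally show ?case .
  qed
  have odd: "Y (Suc (2 * n)) = 0" for n
  proof (induction n)
    case (Suc n)
    then show ?case
      using rec[of "Suc (2 * n)"] of_nat_neq_0[where 'a = complex] by (auto simp del: of_nat_Suc)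
  qed (use Y1 in simp)
  show ?thesis
    by (rule that[OF Y rec even odd])
qed

text \<open>The inner factor 2 enters twice through the chain rule and turns \<open>z\<close> into
  \<open>4 * z\<close>. With \<open>a = n + 1\<close> and \<open>b = 2 * n + 3\<close> the ratio is
  \<open>2 * a / b\<close> times the new factor \<open>1 + z / a^2\<close> of \<open>Q_prod\<close>.
  Indexing by \<open>Suc n\<close> avoids the zero denominator of the term at 0.\<close>

lemma power_series_sinh_sqrt_Arcsin:
  obtains Y where
    "\<And>u. norm u < 1 \<Longrightarrow> (\<lambda>m. Y m * u ^ m) sums (sinh_sqrt z (2 * Arcsin u) / csqrt (1 - u\<^sup>2))"
    "\<And>m. of_nat (Suc m) * of_nat (Suc (Suc m)) * Y (Suc (Suc m)) = ((of_nat (Suc m))\<^sup>2 + 4 * z) * Y m"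
    "\<And>n. Y (Suc (2 * n)) = 4 ^ Suc n / (of_nat (Suc n) * of_nat ((2 * Suc n) choose Suc n)) * Q_prod (Suc n) z"
    "\<And>n. Y (2 * n) = 0"
proof -
  have A: "((\<lambda>u. 2 * Arcsin u) has_field_derivative 2 / csqrt (1 - u\<^sup>2)) (at u)" if "norm u < 1" for u
    using DERIV_cmult[OF has_field_derivative_Arcsin_unit_disc[OF that], of 2] by simp
  have F: "((\<lambda>u. sinh_sqrt z (2 * Arcsin u)) has_field_derivative 2 * cosh_sqrt z (2 * Arcsin u) / csqrt (1 - u\<^sup>2)) (at u)"
    and G: "((\<lambda>u. 2 * cosh_sqrt z (2 * Arcsin u)) has_field_derivative 4 * z * sinh_sqrt z (2 * Arcsin u) / csqrt (1 - u\<^sup>2)) (at u)"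
    if "norm u < 1" for u
    using DERIV_chain2[OF has_field_derivative_sinh_sqrt A[OF that]]
      DERIV_cmult[OF DERIV_chain2[OF has_field_derivative_cosh_sqrt A[OF that]], of 2]
    by (simp_all add: mult_ac)
  obtain Y where Y: "\<And>u. norm u < 1 \<Longrightarrow> (\<lambda>m. Y m * u ^ m) sums (sinh_sqrt z (2 * Arcsin u) / csqrt (1 - u\<^sup>2))"
    and Y0: "Y 0 = sinh_sqrt z (2 * Arcsin 0)" and Y1: "Y 1 = 2 * cosh_sqrt z (2 * Arcsin 0)"
    and rec: "\<And>m. of_nat (Suc m) * of_nat (Suc (Suc m)) * Y (Suc (Suc m)) = ((of_nat (Suc m))\<^sup>2 + 4 * z) * Y m"
    using power_series_div_sqrt[OF F G] by blast
  have odd: "Y (Suc (2 * n)) = 4 ^ Suc n / (of_nat (Suc n) * of_nat ((2 * Suc n) choose Suc n)) * Q_prod (Suc n) z" for n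
  proof (induction n)
    case 0 show ?case using Y1 by (simp add: Q_prod_def)
  next
    case (Suc n)
    define a where "a = (of_nat (Suc n) :: complex)"
    define b where "b = 2 * of_nat (Suc n) + (1 :: complex)"
    define c where "c = (of_nat (Suc (Suc n)) :: complex)"
    define B where "B = (of_nat ((2 * Suc n) choose Suc n) :: complex)"
    have nz: "a \<noteq> 0" "b \<noteq> 0" "c \<noteq> 0" "B \<noteq> 0"
      using two_times_of_nat_plus_one_neq_0[of "Suc n"]
      unfolding a_def b_def c_def B_def by (auto simp del: of_nat_Suc binomial_Suc_Suc mult_Suc_right)
    have Q: "Q_prod (Suc (Suc n)) z = Q_prod (Suc n) z * (1 + z / a\<^sup>2)"
      by (simp add: Q_prod_def a_def)
    have bin: "of_nat ((2 * Suc (Suc n)) choose Suc (Suc n)) = 2 * b * B / c"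
      unfolding b_def B_def c_def by (rule central_binomial_Suc')
    have "of_nat (Suc (Suc (2 * n))) = 2 * a" "of_nat (Suc (Suc (Suc (2 * n)))) = b"
        "Suc (Suc (Suc (2 * n))) = Suc (2 * Suc n)" "(2 * a)\<^sup>2 = 4 * a\<^sup>2"
      by (simp_all add: a_def b_def power2_eq_square algebra_simps)
    with rec[of "Suc (2 * n)"] have "2 * a * b * Y (Suc (2 * Suc n)) = (4 * a\<^sup>2 + 4 * z) * Y (Suc (2 * n))"
      by metis
    then have "Y (Suc (2 * Suc n)) = (4 * a\<^sup>2 + 4 * z) * Y (Suc (2 * n)) / (2 * a * b)"
      using nz by (simp add: field_simps)
    also have "Y (Suc (2 * n)) = 4 ^ Suc n / (a * B) * Q_prod (Suc n) z"
      unfolding a_def B_def by (rule Suc.IH)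
    also have "(4 * a\<^sup>2 + 4 * z) * (4 ^ Suc n / (a * B) * Q_prod (Suc n) z) / (2 * a * b)
        = 4 ^ Suc (Suc n) / (c * (2 * b * B / c)) * (Q_prod (Suc n) z * (1 + z / a\<^sup>2))"
      using nz by (simp add: field_simps power2_eq_square)
    finally show ?case by (simp only: Q bin c_def)
  qed
  have even: "Y (2 * n) = 0" for n
  proof (induction n)
    case (Suc n)
    then show ?case
      using rec[of "2 * n"] of_nat_neq_0[where 'a = complex] by (auto simp del: of_nat_Suc)
  qed (use Y0 in simp)
  show ?thesis
    by (rule that[OF Y rec odd even])
qed

section \<open>Assembly of the two series identities\<close>

theorem theorem5p4:
  fixes q r :: nat and \<omega> z s :: complex and \<eta> :: "nat \<Rightarrow> complex"
  assumes "q \<ge> 1" and "r < q"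
    and "\<omega> = exp (2 * of_real pi * \<i> / of_nat q)"
    and "\<And>l. l < q \<Longrightarrow> \<eta> l = exp (\<i> / 2 * of_real (Arg (\<omega> ^ l)))"
  shows "(Re s > -1 \<longrightarrow>
      (\<forall>l<q. set_integrable lborel {0<..<1::real} (\<lambda>x. of_real x powr s *
          (cosh_sqrt z (Arcsin (\<eta> l * of_real x)) / csqrt (1 - \<omega> ^ l * of_real x ^ 2)))) \<and>
      ((\<lambda>n. of_nat ((2 * n) choose n) / 4 ^ n * (P_prod n z / (2 * of_nat n + s + 1))) has_sum
        1 / of_nat q * (\<Sum>l<q. \<omega> powi (- (int r * int l)) *
          (LINT x:{0<..<1::real}|lborel. of_real x powr s *
            (cosh_sqrt z (Arcsin (\<eta> l * of_real x)) / csqrt (1 - \<omega> ^ l * of_real x ^ 2)))))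
        {n. [n = r] (mod q)}) \<and>
    (Re s > -2 \<longrightarrow>
      (\<forall>l<q. set_integrable lborel {0<..<1::real} (\<lambda>x. of_real x powr s *
          (2 * \<eta> l * sinh_sqrt z (2 * Arcsin (\<eta> l * of_real x)) / csqrt (1 - \<omega> ^ l * of_real x ^ 2)))) \<and>
      ((\<lambda>n. 2 * 4 ^ n / (of_nat n * of_nat ((2 * n) choose n)) * (Q_prod n z / (2 * of_nat n + s))) has_sum
        1 / of_nat q * (\<Sum>l<q. \<omega> powi (- (int r * int l)) *
          (LINT x:{0<..<1::real}|lborel. of_real x powr s *
            (2 * \<eta> l * sinh_sqrt z (2 * Arcsin (\<eta> l * of_real x)) / csqrt (1 - \<omega> ^ l * of_real x ^ 2)))))
        {n. n \<ge> 1 \<and> [n = r] (mod q)})"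
proof -
  \<comment> \<open>Halving the argument makes \<open>\<eta> l\<close> a square root of
    \<open>\<omega> ^ l\<close> on the unit circle, so the radicand of the statement is
    \<open>1 - u^2\<close> at \<open>u = \<eta> l * x\<close>.\<close>
  have eta: "norm (\<eta> l) = 1" "(\<eta> l)\<^sup>2 = \<omega> ^ l" if "l < q" for l
  proof -
    have "norm \<omega> = 1"
      unfolding assms(3) by (simp add: norm_exp_eq_Re)
    then have n1: "norm (\<omega> ^ l) = 1"
      by (simp add: norm_power)
    show "norm (\<eta> l) = 1"
      using assms(4)[OF that] by (simp add: norm_exp_eq_Re)
    have "(\<eta> l)\<^sup>2 = exp (\<i> * of_real (Arg (\<omega> ^ l)))"
      unfolding assms(4)[OF that] by (simp flip: exp_double)
    also have "\<dots> = \<omega> ^ l"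
      using n1 rcis_cmod_Arg[of "\<omega> ^ l"] by (simp add: rcis_def cis_conv_exp)
    finally show "(\<eta> l)\<^sup>2 = \<omega> ^ l" .
  qed
  have arg: "1 - (\<eta> l * of_real x)\<^sup>2 = 1 - \<omega> ^ l * of_real x ^ 2" if "l < q" for l and x :: real
    by (simp add: power_mult_distrib eta(2)[OF that])
  show ?thesis
  proof (intro conjI impI)
    assume s: "Re s > -1"
    obtain Y where Y: "\<And>u. norm u < 1 \<Longrightarrow> (\<lambda>m. Y m * u ^ m) sums (cosh_sqrt z (Arcsin u) / csqrt (1 - u\<^sup>2))"
      and rec: "\<And>m. of_nat (Suc m) * of_nat (Suc (Suc m)) * Y (Suc (Suc m)) = ((of_nat (Suc m))\<^sup>2 + z) * Y m"
      and even: "\<And>n. Y (2 * n) = of_nat ((2 * n) choose n) / 4 ^ n * P_prod n z"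
      and odd: "\<And>n. Y (Suc (2 * n)) = 0"
      using power_series_cosh_sqrt_Arcsin by blast
    have s': "Re s + of_nat m > -1" for m using s by linarith
    define I where "I = (\<lambda>l. LINT x:{0<..<1::real}|lborel. of_real x powr s *
            (cosh_sqrt z (Arcsin (\<eta> l * of_real x)) / csqrt (1 - \<omega> ^ l * of_real x ^ 2)))"
    show "\<forall>l<q. set_integrable lborel {0<..<1::real} (\<lambda>x. of_real x powr s *
          (cosh_sqrt z (Arcsin (\<eta> l * of_real x)) / csqrt (1 - \<omega> ^ l * of_real x ^ 2)))"
      using has_sum_integral_powr_power_series(1)[OF Y rec eta(1) s'] arg by simp
    define t where "t = (\<lambda>n. of_nat ((2 * n) choose n) / 4 ^ n * (P_prod n z / (2 * of_nat n + s + 1)))"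
    have "((\<lambda>n. t n * (\<omega> ^ l) ^ n) has_sum I l) UNIV" if l: "l < q" for l
    proof -
      have "((\<lambda>m. Y m * \<eta> l ^ m / (of_nat m + s + 1)) has_sum I l) UNIV"
        using has_sum_integral_powr_power_series(2)[OF Y rec eta(1)[OF l] s'] arg[OF l] by (simp add: I_def)
      \<comment> \<open>Only even indices contribute; after reindexing,
        \<open>\<eta> l ^ (2 * n)\<close> becomes \<open>(\<omega> ^ l) ^ n\<close>, the form needed
        by the filter.\<close>
      then have "((\<lambda>m. Y m * \<eta> l ^ m / (of_nat m + s + 1)) has_sum I l) (range (\<lambda>n. 2 * n))"
      proof (rule has_sum_cong_neutral[THEN iffD1, rotated -1])
        fix m :: nat assume "m \<in> UNIV - range (\<lambda>n. 2 * n)"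
        then have "odd m" by (auto elim!: evenE)
        then show "Y m * \<eta> l ^ m / (of_nat m + s + 1) = 0"
          by (auto elim!: oddE simp: odd)
      qed auto
      then have "((\<lambda>n. Y (2 * n) * \<eta> l ^ (2 * n) / (of_nat (2 * n) + s + 1)) has_sum I l) UNIV"
        by (subst (asm) has_sum_reindex) (auto simp: inj_on_def o_def)
      moreover have "Y (2 * n) * \<eta> l ^ (2 * n) / (of_nat (2 * n) + s + 1) = t n * (\<omega> ^ l) ^ n" for n
        unfolding even t_def power_mult eta(2)[OF l] by simp
      ultimately show ?thesis by simp
    qed
    then have "(t has_sum 1 / of_nat q * (\<Sum>l<q. \<omega> powi (- (int r * int l)) * I l)) {n \<in> UNIV. [n = r] (mod q)}"
      by (rule has_sum_residue_class[OF assms(1,3)])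
    then show "((\<lambda>n. of_nat ((2 * n) choose n) / 4 ^ n * (P_prod n z / (2 * of_nat n + s + 1))) has_sum
        1 / of_nat q * (\<Sum>l<q. \<omega> powi (- (int r * int l)) *
          (LINT x:{0<..<1::real}|lborel. of_real x powr s *
            (cosh_sqrt z (Arcsin (\<eta> l * of_real x)) / csqrt (1 - \<omega> ^ l * of_real x ^ 2)))))
        {n. [n = r] (mod q)}"
      by (simp add: t_def I_def)
  next
    assume s: "Re s > -2"
    obtain Y where Y: "\<And>u. norm u < 1 \<Longrightarrow> (\<lambda>m. Y m * u ^ m) sums (sinh_sqrt z (2 * Arcsin u) / csqrt (1 - u\<^sup>2))"
      and rec: "\<And>m. of_nat (Suc m) * of_nat (Suc (Suc m)) * Y (Suc (Suc m)) = ((of_nat (Suc m))\<^sup>2 + 4 * z) * Y m"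
      and odd: "\<And>n. Y (Suc (2 * n)) = 4 ^ Suc n / (of_nat (Suc n) * of_nat ((2 * Suc n) choose Suc n)) * Q_prod (Suc n) z"
      and even: "\<And>n. Y (2 * n) = 0"
      using power_series_sinh_sqrt_Arcsin by blast
    define I where "I = (\<lambda>l. LINT x:{0<..<1::real}|lborel. of_real x powr s *
            (2 * \<eta> l * sinh_sqrt z (2 * Arcsin (\<eta> l * of_real x)) / csqrt (1 - \<omega> ^ l * of_real x ^ 2)))"
    define t where "t = (\<lambda>n. 2 * 4 ^ n / (of_nat n * of_nat ((2 * n) choose n)) * (Q_prod n z / (2 * of_nat n + s)))"
    have *: "set_integrable lborel {0<..<1::real} (\<lambda>x. of_real x powr s *
          (2 * \<eta> l * sinh_sqrt z (2 * Arcsin (\<eta> l * of_real x)) / csqrt (1 - \<omega> ^ l * of_real x ^ 2)))"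
      "((\<lambda>m. 2 * \<eta> l * Y m * \<eta> l ^ m / (of_nat m + s + 1)) has_sum I l) UNIV" if l: "l < q" for l
    proof -
      \<comment> \<open>The recurrence is homogeneous, so the constant \<open>2 * \<eta> l\<close>
        can be absorbed into the coefficients.\<close>
      have Y': "(\<lambda>m. 2 * \<eta> l * Y m * u ^ m) sums (2 * \<eta> l * sinh_sqrt z (2 * Arcsin u) / csqrt (1 - u\<^sup>2))"
        if "norm u < 1" for u
        using sums_mult[OF Y[OF that], of "2 * \<eta> l"] by (simp add: mult.assoc)
      have rec': "of_nat (Suc m) * of_nat (Suc (Suc m)) * (2 * \<eta> l * Y (Suc (Suc m)))
          = ((of_nat (Suc m))\<^sup>2 + 4 * z) * (2 * \<eta> l * Y m)" for m
        using rec[of m] by algebra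
      \<comment> \<open>Since \<open>Y 0 = 0\<close>, a nonzero coefficient has
        \<open>m \<ge> 1\<close>, and this is where \<open>Re s > -2\<close> suffices.\<close>
      have s': "Re s + of_nat m > -1" if "2 * \<eta> l * Y m \<noteq> 0" for m
        using that s even[of 0] by (cases m) auto
      show "set_integrable lborel {0<..<1::real} (\<lambda>x. of_real x powr s *
          (2 * \<eta> l * sinh_sqrt z (2 * Arcsin (\<eta> l * of_real x)) / csqrt (1 - \<omega> ^ l * of_real x ^ 2)))"
        using has_sum_integral_powr_power_series(1)[OF Y' rec' eta(1)[OF l] s'] arg[OF l] by simp
      show "((\<lambda>m. 2 * \<eta> l * Y m * \<eta> l ^ m / (of_nat m + s + 1)) has_sum I l) UNIV"
        using has_sum_integral_powr_power_series(2)[OF Y' rec' eta(1)[OF l] s'] arg[OF l] by (simp add: I_def)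
    qed
    show "\<forall>l<q. set_integrable lborel {0<..<1::real} (\<lambda>x. of_real x powr s *
          (2 * \<eta> l * sinh_sqrt z (2 * Arcsin (\<eta> l * of_real x)) / csqrt (1 - \<omega> ^ l * of_real x ^ 2)))"
      using *(1) by blast
    have "((\<lambda>n. t n * (\<omega> ^ l) ^ n) has_sum I l) {1..}" if l: "l < q" for l
    proof -
      \<comment> \<open>Odd indices are written \<open>2 * n - 1\<close> with
        \<open>n \<ge> 1\<close>, where the subtraction does not truncate. The denominator becomes
        \<open>2 * n + s\<close>, and the extra \<open>\<eta> l\<close> completes the odd power to
        \<open>\<eta> l ^ (2 * n)\<close>.\<close>
      have "((\<lambda>m. 2 * \<eta> l * Y m * \<eta> l ^ m / (of_nat m + s + 1)) has_sum I l) ((\<lambda>n. 2 * n - 1) ` {1..})"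
        using *(2)[OF l]
      proof (rule has_sum_cong_neutral[THEN iffD1, rotated -1])
        fix m :: nat assume m: "m \<in> UNIV - (\<lambda>n. 2 * n - 1) ` {1..}"
        have "even m"
        proof (rule ccontr)
          assume "odd m"
          then obtain k where "m = 2 * k + 1" by (elim oddE)
          then have "m = 2 * Suc k - 1" "Suc k \<in> {1..}" by auto
          with m show False by blast
        qed
        then show "2 * \<eta> l * Y m * \<eta> l ^ m / (of_nat m + s + 1) = 0"
          by (auto elim!: evenE simp: even)
      qed auto
      then have "((\<lambda>n. 2 * \<eta> l * Y (2 * n - 1) * \<eta> l ^ (2 * n - 1) / (of_nat (2 * n - 1) + s + 1)) has_sum I l) {1..}"
        by (subst (asm) has_sum_reindex) (auto simp: inj_on_def o_def)
      moreover have "2 * \<eta> l * Y (2 * n - 1) * \<eta> l ^ (2 * n - 1) / (of_nat (2 * n - 1) + s + 1) = t n * (\<omega> ^ l) ^ n"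
        if "n \<in> {1..}" for n
      proof -
        obtain k where k: "n = Suc k" using \<open>n \<in> {1..}\<close> by (cases n) auto
        have "2 * \<eta> l * Y (2 * n - 1) * \<eta> l ^ (2 * n - 1) / (of_nat (2 * n - 1) + s + 1)
            = 2 * Y (Suc (2 * k)) / (2 * of_nat n + s) * \<eta> l ^ (2 * n)"
          by (simp add: k add_ac)
        also have "\<dots> = t n * (\<omega> ^ l) ^ n"
          by (simp only: odd t_def k power_mult eta(2)[OF l]) (simp add: mult_ac)
        finally show ?thesis .
      qed
      ultimately show ?thesis
        by (subst (asm) has_sum_cong) auto
    qed
    then have "(t has_sum 1 / of_nat q * (\<Sum>l<q. \<omega> powi (- (int r * int l)) * I l)) {n \<in> {1..}. [n = r] (mod q)}"
      by (rule has_sum_residue_class[OF assms(1,3)])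
    then show "((\<lambda>n. 2 * 4 ^ n / (of_nat n * of_nat ((2 * n) choose n)) * (Q_prod n z / (2 * of_nat n + s))) has_sum
        1 / of_nat q * (\<Sum>l<q. \<omega> powi (- (int r * int l)) *
          (LINT x:{0<..<1::real}|lborel. of_real x powr s *
            (2 * \<eta> l * sinh_sqrt z (2 * Arcsin (\<eta> l * of_real x)) / csqrt (1 - \<omega> ^ l * of_real x ^ 2)))))
        {n. n \<ge> 1 \<and> [n = r] (mod q)}"
      by (simp only: t_def I_def atLeast_iff)
  qed
qed

end
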